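(* Let $H=C_a\square C_b$ be the toroidal grid with $a,b\geq 13$, let $n=ab$, and identify $V(H)$ with $[n]$. Then the set of all straight paths in $H$ with $5$ vertices is a resolving set for the Kneser graph $K(n,5)$. Therefore, for such $n$, $\beta(K(n,5))\leq 2n$.
   Context: The toroidal grid $C_a\square C_b$ has vertex set $\mathbb{Z}_a\times\mathbb{Z}_b$, with $(i,j)$ adjacent to $(i\pm1,j)$ and $(i,j\pm1)$. A straight path with $m$ vertices is a vertex set of the form $\{(i,j),(i+1,j),\dots,(i+m-1,j)\}$ or $\{(i,j),(i,j+1),\dots,(i,j+m-1)\}$ (so there are $2ab$ of them for each fixed $m$ smaller than $a,b$). The Kneser graph $K(n,k)$ has as vertices the $k$-subsets of $[n]$, adjacent when disjoint. A resolving set is a set $\mathcal{S}$ of vertices such that for all distinct vertices $U,W$ some $X\in\mathcal{S}$ has $d(U,X)\neq d(W,X)$; $\beta$ is the minimum size of a resolving set. *)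

theory Defs
  imports "Graph_Theory.Pair_Digraph" "Graph_Theory.Shortest_Path"
begin

text \<open>A simple graph is a \<^locale>\<open>pair_graph\<close>, in which every edge is represented by
  its two arcs. The graph distance is the shortest-path distance for unit arc weights;
  it is infinite between different components.\<close>

definition graph_dist :: "'a pair_pre_digraph \<Rightarrow> 'a \<Rightarrow> 'a \<Rightarrow> ereal" where
  "graph_dist G u v = wf_digraph.\<mu> (with_proj G) (\<lambda>_. 1) u v"

definition resolving_set :: "'a pair_pre_digraph \<Rightarrow> 'a set \<Rightarrow> bool" where
  "resolving_set G S \<longleftrightarrow> S \<subseteq> pverts G \<and>
     (\<forall>U\<in>pverts G. \<forall>W\<in>pverts G. U \<noteq> W \<longrightarrow> (\<exists>X\<in>S. graph_dist G U X \<noteq> graph_dist G W X))"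

text \<open>Meaningful for finite graphs, whose vertex set is always a resolving set.\<close>

definition metric_dimension :: "'a pair_pre_digraph \<Rightarrow> nat" where
  "metric_dimension G = (LEAST m. \<exists>S. resolving_set G S \<and> finite S \<and> card S = m)"

definition kneser_graph :: "nat \<Rightarrow> nat \<Rightarrow> nat set pair_pre_digraph" where
  "kneser_graph n k =
     \<lparr> pverts = {A. A \<subseteq> {1..n} \<and> card A = k},
       parcs = {(A, B). A \<subseteq> {1..n} \<and> card A = k \<and> B \<subseteq> {1..n} \<and> card B = k \<and> A \<inter> B = {}} \<rparr>"

text \<open>The residue classes modulo \<open>a\<close> are represented by \<open>0, \<dots>, a - 1\<close>.\<close>

definition cyc_adj :: "nat \<Rightarrow> nat \<Rightarrow> nat \<Rightarrow> bool" where
  "cyc_adj a i j \<longleftrightarrow> j = (i + 1) mod a \<or> i = (j + 1) mod a"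

definition toroidal_grid :: "nat \<Rightarrow> nat \<Rightarrow> (nat \<times> nat) pair_pre_digraph" where
  "toroidal_grid a b =
     \<lparr> pverts = {0..<a} \<times> {0..<b},
       parcs = {((i, j), (i', j')). i < a \<and> i' < a \<and> j < b \<and> j' < b \<and>
                  (cyc_adj a i i' \<and> j = j' \<or> i = i' \<and> cyc_adj b j j')} \<rparr>"

definition straight_paths :: "nat \<Rightarrow> nat \<Rightarrow> nat \<Rightarrow> (nat \<times> nat) set set" where
  "straight_paths a b m =
     {(\<lambda>t. ((i + t) mod a, j)) ` {0..<m} | i j. (i, j) \<in> pverts (toroidal_grid a b)} \<union>
     {(\<lambda>t. (i, (j + t) mod b)) ` {0..<m} | i j. (i, j) \<in> pverts (toroidal_grid a b)}"

lemma pair_graph_kneser_graph: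
  assumes "k \<ge> 1"
  shows "pair_graph (kneser_graph n k)"
proof -
  let ?G = "kneser_graph n k"
  have fin: "finite {A. A \<subseteq> {1..n} \<and> card A = k}" by simp
  have 1: "finite (parcs ?G)"
    by (rule finite_subset[OF _ finite_cartesian_product[OF fin fin]])
      (auto simp: kneser_graph_def)
  have 2: "finite (pverts ?G)" using fin by (simp add: kneser_graph_def)
  have 3: "fst e \<in> pverts ?G" "snd e \<in> pverts ?G" if "e \<in> parcs ?G" for e
    using that by (auto simp: kneser_graph_def)
  have 4: "fst e \<noteq> snd e" if "e \<in> parcs ?G" for e
    using that assms by (cases e) (auto simp: kneser_graph_def)
  have 5: "symmetric (with_proj ?G)"
    unfolding symmetric_def with_proj_simps
    by (rule symI) (simp add: kneser_graph_def Int_commute)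
  show ?thesis
    by unfold_locales (fact 1 2 3 4 5)+
qed

lemma pair_graph_toroidal_grid:
  assumes "a \<ge> 2" and "b \<ge> 2"
  shows "pair_graph (toroidal_grid a b)"
proof -
  let ?G = "toroidal_grid a b"
  have fin: "finite ({0..<a} \<times> {0..<b})" by simp
  have irrefl: "\<not> cyc_adj c i i" if "c \<ge> 2" "i < c" for c i
    using that unfolding cyc_adj_def by (cases "i + 1 = c") auto
  have commute: "cyc_adj c i j \<longleftrightarrow> cyc_adj c j i" for c i j
    unfolding cyc_adj_def by blast
  have 1: "finite (parcs ?G)"
    by (rule finite_subset[OF _ finite_cartesian_product[OF fin fin]])
      (auto simp: toroidal_grid_def)
  have 2: "finite (pverts ?G)" using fin by (simp add: toroidal_grid_def)
  have 3: "fst e \<in> pverts ?G" "snd e \<in> pverts ?G" if "e \<in> parcs ?G" for e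
    using that by (auto simp: toroidal_grid_def)
  have 4: "fst e \<noteq> snd e" if "e \<in> parcs ?G" for e
    using that assms irrefl by (auto simp: toroidal_grid_def)
  have 5: "symmetric (with_proj ?G)"
    unfolding symmetric_def with_proj_simps
    by (rule symI) (auto simp: toroidal_grid_def commute)
  show ?thesis
    by unfold_locales (fact 1 2 3 4 5)+
qed

end

theory Submission
  imports Defs "HOL-Number_Theory.Cong"
begin

text \<open>In \<open>K(n,5)\<close> a path \<open>X\<close> separates \<open>U\<close> from \<open>W\<close> as soon as it meets exactly one of them.
  If no path does, every element of \<open>U - W\<close> has, in its row and in its column, elements of \<open>W\<close> on
  both sides at total distance at most 5, and conversely for \<open>W - U\<close>. Following such neighbours
  along a row or column through an element of the symmetric difference yields, before the
  cycle closes up, two elements of \<open>U \<inter> W\<close> or four of the symmetric difference. Four are too many,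
  because each of them again has two companions on the transversal line. Hence \<open>U \<inter> W\<close> has exactly
  two elements in the row and two in the column of some \<open>u \<in> U - W\<close>, and likewise for some
  \<open>w \<in> W - U\<close>, which forces \<open>u = w\<close>.\<close>

section \<open>Sets of integers meeting the same windows\<close>

text \<open>A window is a path of five vertices on one row or column, unrolled to the integers.
  \<open>P\<close> and \<open>Q\<close> will be preimages of \<open>U\<close> and \<open>W\<close>
  under a periodic map.\<close>

definition window_equiv :: "int set \<Rightarrow> int set \<Rightarrow> bool" where
  "window_equiv P Q \<longleftrightarrow> (\<forall>s. {s..s+4} \<inter> P = {} \<longleftrightarrow> {s..s+4} \<inter> Q = {})"

lemma window_equiv_sym: "window_equiv P Q \<Longrightarrow> window_equiv Q P"
  by (auto simp: window_equiv_def)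

lemma mem_uminus_image: "x \<in> uminus ` (P :: int set) \<longleftrightarrow> - x \<in> P"
  by (metis image_iff minus_equation_iff)

text \<open>Reflection exchanges left and right, so only a right neighbour outside \<open>P\<close>
  needs a detailed case analysis.\<close>

lemma window_equiv_uminus:
  assumes "window_equiv P Q"
  shows "window_equiv (uminus ` P) (uminus ` Q)"
  unfolding window_equiv_def
proof
  fix s :: int
  have *: "{s..s+4} \<inter> uminus ` R = uminus ` ({-s-4..(-s-4)+4} \<inter> R)" for R
    by (auto simp: mem_uminus_image)
  show "{s..s+4} \<inter> uminus ` P = {} \<longleftrightarrow> {s..s+4} \<inter> uminus ` Q = {}"
    unfolding * using assms by (simp only: window_equiv_def image_is_empty)
qed

text \<open>\<open>x\<close> and \<open>y\<close> are the elements of \<open>Q\<close> nearest to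
  \<open>u\<close>. The window starting at \<open>x + 1\<close> contains \<open>u\<close> and hence
  meets \<open>Q\<close>, but only beyond \<open>u\<close>, that is, at \<open>y\<close> or
  later.\<close>

lemma window_equiv_nearest:
  assumes "window_equiv P Q" "u \<in> P" "u \<notin> Q"
  obtains x y where "x < u" "u < y" "y \<le> x + 5" "x \<in> Q" "y \<in> Q"
    "\<And>z. x < z \<Longrightarrow> z < y \<Longrightarrow> z \<notin> Q"
proof -
  have hit: "\<exists>z\<in>Q. s \<le> z \<and> z \<le> s + 4" if "s \<le> u" "u \<le> s + 4" for s
  proof -
    have "{s..s+4} \<inter> P \<noteq> {}" using that assms(2) by auto
    then have "{s..s+4} \<inter> Q \<noteq> {}" using assms(1) by (simp add: window_equiv_def)
    then show ?thesis by auto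
  qed
  define x where "x = Max (Q \<inter> {u-4..u})"
  define y where "y = Min (Q \<inter> {u..u+4})"
  have "Q \<inter> {u-4..u} \<noteq> {}" using hit[of "u-4"] by auto
  then have x: "x \<in> Q \<inter> {u-4..u}" unfolding x_def by (intro Max_in) auto
  have "Q \<inter> {u..u+4} \<noteq> {}" using hit[of u] by auto
  then have y: "y \<in> Q \<inter> {u..u+4}" unfolding y_def by (intro Min_in) auto
  have xmax: "z \<le> x" if "z \<in> Q" "z \<le> u" for z
  proof (cases "z \<ge> u - 4")
    case True then show ?thesis using that by (auto simp: x_def)
  qed (use x in auto)
  have ymin: "y \<le> z" if "z \<in> Q" "u \<le> z" for z
  proof (cases "z \<le> u + 4")
    case True then show ?thesis using that by (auto simp: y_def)
  qed (use y in auto)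
  have xu: "x < u" using x assms(3) by (cases "x = u") auto
  have uy: "u < y" using y assms(3) by (cases "y = u") auto
  obtain z where z: "z \<in> Q" "x + 1 \<le> z" "z \<le> x + 5"
    using hit[of "x+1"] x xu by auto
  have "u \<le> z" using xmax[OF z(1)] z by linarith
  then have "y \<le> x + 5" using ymin[OF z(1)] z by linarith
  moreover have "z \<notin> Q" if "x < z" "z < y" for z
    using xmax[of z] ymin[of z] that by linarith
  ultimately show thesis using that xu uy x y by blast
qed

text \<open>The span below 13 keeps the points distinct modulo any \<open>a \<ge> 13\<close>, so
  they remain different vertices once the cycle is closed up again.\<close>

definition rich :: "int set \<Rightarrow> int set \<Rightarrow> bool" where
  "rich P Q \<longleftrightarrow> (\<exists>p q. p < q \<and> q < p + 13 \<and> {p, q} \<subseteq> P \<inter> Q) \<or>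
     (\<exists>p q r s. p < q \<and> q < r \<and> r < s \<and> s < p + 13 \<and> {p, q, r, s} \<subseteq> sym_diff P Q)"

lemma rich_common: "p < q \<Longrightarrow> q < p + 13 \<Longrightarrow> {p, q} \<subseteq> P \<inter> Q \<Longrightarrow> rich P Q"
  unfolding rich_def by blast

lemma rich_sym_diff:
  "p < q \<Longrightarrow> q < r \<Longrightarrow> r < s \<Longrightarrow> s < p + 13 \<Longrightarrow> {p, q, r, s} \<subseteq> sym_diff P Q \<Longrightarrow> rich P Q"
  unfolding rich_def by blast

lemma rich_sym: "rich P Q \<Longrightarrow> rich Q P"
  by (simp add: rich_def Un_commute Int_commute)

lemma rich_uminus:
  assumes "rich (uminus ` P) (uminus ` Q)"
  shows "rich P Q"
  using assms[unfolded rich_def]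
proof (elim disjE exE conjE)
  fix p q assume "p < q" "q < p + 13" "{p, q} \<subseteq> uminus ` P \<inter> uminus ` Q"
  then show ?thesis by (intro rich_common[of "-q" "-p"]) (auto simp: mem_uminus_image)
next
  fix p q r s
  assume "p < q" "q < r" "r < s" "s < p + 13"
    "{p, q, r, s} \<subseteq> sym_diff (uminus ` P) (uminus ` Q)"
  then show ?thesis
    by (intro rich_sym_diff[of "-s" "-r" "-q" "-p"]) (simp_all add: mem_uminus_image)
qed

text \<open>Taking nearest elements matters: with arbitrary ones within distance 4 the four points
  could spread over 13 positions and coincide modulo 13.\<close>

lemma rich_if_right_neighbour:
  assumes eq: "window_equiv P Q" and u: "u \<in> P" "u \<notin> Q"
    and xy: "x < u" "u < y" "y \<le> x + 5" "x \<in> Q" "y \<in> Q"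
    and gap: "\<And>z. x < z \<Longrightarrow> z < y \<Longrightarrow> z \<notin> Q"
    and y: "y \<notin> P"
  shows "rich P Q"
proof -
  obtain v w where vw: "v < y" "y < w" "w \<le> v + 5" "v \<in> P" "w \<in> P"
    and gap': "\<And>z. v < z \<Longrightarrow> z < w \<Longrightarrow> z \<notin> P"
    using window_equiv_nearest[OF window_equiv_sym[OF eq] \<open>y \<in> Q\<close> y] by blast
  \<comment> \<open>\<open>u\<close> lies in \<open>P\<close> and to the left of \<open>w\<close>,
    so it cannot fall into the gap between \<open>v\<close> and \<open>w\<close>.\<close>
  have uv: "u \<le> v" using gap'[of u] u xy vw by force
  \<comment> \<open>Unless \<open>x\<close> and \<open>w\<close> are both common, one of them joins
    \<open>u\<close> and \<open>y\<close> in the symmetric difference; \<open>v\<close> is a fourth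
    such point if it differs from \<open>u\<close>.\<close>
  consider "x \<in> P" "w \<in> Q" | "u < v" "w \<notin> Q" | "u < v" "x \<notin> P" | "u = v" "w \<notin> Q" | "u = v" "x \<notin> P"
    using uv by force
  then show ?thesis
  proof cases
    case 1
    then show ?thesis using xy vw by (intro rich_common[of x w]) auto
  next
    case 2
    have "v \<notin> Q" using gap[of v] xy vw 2 by auto
    then show ?thesis using xy vw u y 2 by (intro rich_sym_diff[of u v y w]) auto
  next
    case 3
    have "v \<notin> Q" using gap[of v] xy vw 3 by auto
    then show ?thesis using xy vw u y 3 by (intro rich_sym_diff[of x u v y]) auto
  next
    case 4
    \<comment> \<open>Only \<open>u\<close>, \<open>y\<close> and \<open>w\<close> are certain here,
      so the chain is continued one step to the right, to the elements of \<open>Q\<close> around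
      \<open>w\<close>.\<close>
    obtain x' y' where x'y': "x' < w" "w < y'" "y' \<le> x' + 5" "x' \<in> Q" "y' \<in> Q"
      and gap'': "\<And>z. x' < z \<Longrightarrow> z < y' \<Longrightarrow> z \<notin> Q"
      using window_equiv_nearest[OF eq \<open>w \<in> P\<close> \<open>w \<notin> Q\<close>] by blast
    have "y \<le> x'" using gap''[of y] xy vw x'y' by force
    then consider "y < x'" | "y = x'" "y' \<notin> P" | "y = x'" "x \<notin> P" | "y = x'" "y' \<in> P" "x \<in> P"
      by force
    then show ?thesis
    proof cases
      case 1
      have "x' \<notin> P" using gap'[of x'] vw x'y' 1 by auto
      then show ?thesis using xy vw x'y' u y 4 1 by (intro rich_sym_diff[of u y x' w]) auto
    next
      case 2
      then show ?thesis using xy vw x'y' u y 4 by (intro rich_sym_diff[of u y w y']) auto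
    next
      case 3
      then show ?thesis using xy vw x'y' u y 4 by (intro rich_sym_diff[of x u y w]) auto
    next
      case c: 4
      then show ?thesis using xy vw x'y' u y by (intro rich_common[of x y']) auto
    qed
  next
    case 5
    \<comment> \<open>The mirror image of the previous case: the chain is continued to the left, to
      the elements of \<open>P\<close> around \<open>x\<close>.\<close>
    obtain x' y' where x'y': "x' < x" "x < y'" "y' \<le> x' + 5" "x' \<in> P" "y' \<in> P"
      and gap'': "\<And>z. x' < z \<Longrightarrow> z < y' \<Longrightarrow> z \<notin> P"
      using window_equiv_nearest[OF window_equiv_sym[OF eq] \<open>x \<in> Q\<close> \<open>x \<notin> P\<close>] by blast
    have "y' \<le> u" using gap''[of u] xy x'y' u by force
    then consider "y' < u" | "y' = u" "x' \<notin> Q" | "y' = u" "w \<notin> Q" | "y' = u" "x' \<in> Q" "w \<in> Q"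
      by force
    then show ?thesis
    proof cases
      case 1
      have "y' \<notin> Q" using gap[of y'] xy x'y' 1 by auto
      then show ?thesis using xy x'y' u y 5 1 by (intro rich_sym_diff[of x y' u y]) auto
    next
      case 2
      then show ?thesis using xy x'y' u y 5 by (intro rich_sym_diff[of x' x u y]) auto
    next
      case 3
      then show ?thesis using xy vw u y 5 by (intro rich_sym_diff[of x u y w]) auto
    next
      case 4
      then show ?thesis using xy vw x'y' 5 by (intro rich_common[of x' w]) auto
    qed
  qed
qed

text \<open>If both nearest elements of \<open>Q\<close> lie in \<open>P\<close>, they are the
  common pair; otherwise the one outside \<open>P\<close> is on the right, possibly after
  reflection.\<close>

lemma rich_if_mem_diff:
  assumes eq: "window_equiv P Q" and u: "u \<in> P" "u \<notin> Q"
  shows "rich P Q"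
proof -
  obtain x y where xy: "x < u" "u < y" "y \<le> x + 5" "x \<in> Q" "y \<in> Q"
    and gap: "\<And>z. x < z \<Longrightarrow> z < y \<Longrightarrow> z \<notin> Q"
    using window_equiv_nearest[OF eq u] by blast
  consider "y \<notin> P" | "x \<notin> P" | "x \<in> P" "y \<in> P" by blast
  then show ?thesis
  proof cases
    case 1
    then show ?thesis using rich_if_right_neighbour[OF eq u xy gap] by blast
  next
    case 2
    have "rich (uminus ` P) (uminus ` Q)"
      by (rule rich_if_right_neighbour[OF window_equiv_uminus[OF eq], of "-u" "-y" "-x"])
        (use u xy gap 2 in \<open>auto simp: mem_uminus_image\<close>)
    then show ?thesis by (rule rich_uminus)
  next
    case 3
    then show ?thesis using xy by (intro rich_common[of x y]) auto
  qed
qed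

lemma rich_if_mem_sym_diff: "window_equiv P Q \<Longrightarrow> u \<in> sym_diff P Q \<Longrightarrow> rich P Q"
  using rich_if_mem_diff window_equiv_sym rich_sym by blast

section \<open>Cycles\<close>

text \<open>\<open>pos\<close> enumerates a row or column. Its periodic extension \<open>f\<close>
  to the integers turns cyclic paths into windows, and the points supplied by \<open>rich\<close>
  are too close together for \<open>f\<close> to identify any two.\<close>

lemma cycle_sym_diff_imp:
  fixes pos :: "nat \<Rightarrow> 'v"
  assumes a: "a \<ge> 13" and inj: "inj_on pos {0..<a}"
    and hits: "\<And>i. i < a \<Longrightarrow> (\<lambda>t. pos ((i + t) mod a)) ` {0..<5} \<inter> U = {} \<longleftrightarrow>
                 (\<lambda>t. pos ((i + t) mod a)) ` {0..<5} \<inter> W = {}"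
    and u: "u \<in> sym_diff U W" "u \<in> pos ` {0..<a}" and fin: "finite U" "finite W"
  shows "card (U \<inter> W \<inter> pos ` {0..<a}) \<ge> 2 \<or> card (sym_diff U W \<inter> pos ` {0..<a}) \<ge> 4"
proof -
  define f where "f x = pos (nat (x mod int a))" for x
  have f_in: "f x \<in> pos ` {0..<a}" for x
    using a by (auto simp: f_def nat_less_iff)
  \<comment> \<open>A coincidence would make \<open>y - x\<close> a positive multiple of
    \<open>a\<close>, hence at least 13.\<close>
  have f_neq: "f x \<noteq> f y" if "x < y" "y < x + 13" for x y
  proof
    assume "f x = f y"
    then have "nat (x mod int a) = nat (y mod int a)"
      using a by (intro inj_onD[OF inj]) (auto simp: f_def nat_less_iff)
    then have "x mod int a = y mod int a" using a by (simp add: eq_nat_nat_iff)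
    then have "int a dvd y - x" by (simp add: mod_eq_dvd_iff dvd_diff_commute)
    then have "int a \<le> y - x" using that by (intro zdvd_imp_le) auto
    then show False using that a by linarith
  qed
  have window: "f ` {s..s+4} = (\<lambda>t. pos ((nat (s mod int a) + t) mod a)) ` {0..<5}" for s
  proof -
    have "{s..s+4} = (\<lambda>t. s + int t) ` {0..<5}"
    proof (intro equalityI subsetI)
      fix x assume "x \<in> {s..s+4}"
      then show "x \<in> (\<lambda>t. s + int t) ` {0..<5}"
        by (intro image_eqI[of _ _ "nat (x - s)"]) auto
    qed auto
    moreover have "f (s + int t) = pos ((nat (s mod int a) + t) mod a)" for t
    proof -
      have "int ((nat (s mod int a) + t) mod a) = (s + int t) mod int a"
        using a by (simp add: zmod_int mod_add_left_eq)
      then show ?thesis unfolding f_def by (metis nat_int)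
    qed
    ultimately show ?thesis by (simp add: image_image)
  qed
  have "window_equiv (f -` U) (f -` W)"
    unfolding window_equiv_def
  proof
    fix s :: int
    have *: "{s..s+4} \<inter> f -` R = {} \<longleftrightarrow> f ` {s..s+4} \<inter> R = {}" for R by auto
    have "nat (s mod int a) < a" using a by (simp add: nat_less_iff)
    then show "{s..s+4} \<inter> f -` U = {} \<longleftrightarrow> {s..s+4} \<inter> f -` W = {}"
      unfolding * window by (rule hits)
  qed
  moreover obtain i where "i < a" "u = pos i" using u(2) by auto
  then have "int i \<in> sym_diff (f -` U) (f -` W)" using u(1) by (simp add: f_def)
  ultimately have "rich (f -` U) (f -` W)" by (rule rich_if_mem_sym_diff)
  then show ?thesis
    unfolding rich_def
  proof (elim disjE exE conjE)
    fix p q assume pq: "p < q" "q < p + 13" "{p, q} \<subseteq> f -` U \<inter> f -` W"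
    have "card {f p, f q} = 2" using f_neq pq by simp
    moreover have "card {f p, f q} \<le> card (U \<inter> W \<inter> pos ` {0..<a})"
      using pq f_in fin by (intro card_mono) auto
    ultimately show ?thesis by simp
  next
    fix p q r s
    assume pq: "p < q" "q < r" "r < s" "s < p + 13" "{p, q, r, s} \<subseteq> sym_diff (f -` U) (f -` W)"
    have "card {f p, f q, f r, f s} = 4" using f_neq pq by simp
    moreover have "card {f p, f q, f r, f s} \<le> card (sym_diff U W \<inter> pos ` {0..<a})"
      using pq f_in fin by (intro card_mono) auto
    ultimately show ?thesis by simp
  qed
qed

section \<open>Rows and columns\<close>

text \<open>A line with four elements of the symmetric difference would force four transversal
  lines with three elements of \<open>U \<union> W\<close> each, but \<open>U \<union> W\<close> has at most ten elements.\<close>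

lemma line_card_common_ge_2:
  fixes f g :: "'v \<Rightarrow> 'c"
  assumes card: "card U = 5" "card W = 5"
    and inj: "\<And>x y. f x = f y \<Longrightarrow> g x = g y \<Longrightarrow> x = y"
    and f: "\<And>d. d \<in> sym_diff U W \<Longrightarrow>
      card {v \<in> U \<inter> W. f v = f d} \<ge> 2 \<or> card {v \<in> sym_diff U W. f v = f d} \<ge> 4"
    and g: "\<And>d. d \<in> sym_diff U W \<Longrightarrow>
      card {v \<in> U \<inter> W. g v = g d} \<ge> 2 \<or> card {v \<in> sym_diff U W. g v = g d} \<ge> 4"
    and d: "d \<in> sym_diff U W"
  shows "card {v \<in> U \<inter> W. f v = f d} \<ge> 2"
proof (rule ccontr)
  assume "\<not> ?thesis"
  then have "card {v \<in> sym_diff U W. f v = f d} \<ge> 4" using f[OF d] by blast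
  then obtain T where T: "T \<subseteq> {v \<in> sym_diff U W. f v = f d}" "card T = 4" "finite T"
    using obtain_subset_with_card_n by blast
  have fin: "finite U" "finite W" using card by (auto intro: card_ge_0_finite)
  have three: "card {v \<in> U \<union> W. g v = g t} \<ge> 3" if "t \<in> T" for t
  proof -
    have t: "t \<in> sym_diff U W" using that T by auto
    show ?thesis
      using g[OF t]
    proof
      assume "card {v \<in> U \<inter> W. g v = g t} \<ge> 2"
      then have "card (insert t {v \<in> U \<inter> W. g v = g t}) \<ge> 3"
        using t fin by (subst card_insert_disjoint) auto
      also have "card (insert t {v \<in> U \<inter> W. g v = g t}) \<le> card {v \<in> U \<union> W. g v = g t}"
        using t fin by (intro card_mono) auto
      finally show ?thesis .
    next
      assume "card {v \<in> sym_diff U W. g v = g t} \<ge> 4"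
      also have "card {v \<in> sym_diff U W. g v = g t} \<le> card {v \<in> U \<union> W. g v = g t}"
        using fin by (intro card_mono) auto
      finally show ?thesis by simp
    qed
  qed
  have "12 = (\<Sum>t\<in>T. 3 :: nat)" using T by simp
  also have "\<dots> \<le> (\<Sum>t\<in>T. card {v \<in> U \<union> W. g v = g t})" by (intro sum_mono three)
  also have "\<dots> = card (\<Union>t\<in>T. {v \<in> U \<union> W. g v = g t})"
  proof (rule card_UN_disjoint[symmetric])
    \<comment> \<open>Members of \<open>T\<close> share their \<open>f\<close>-line, so two of them
      on one \<open>g\<close>-line would be equal by \<open>inj\<close>.\<close>
    have "g s \<noteq> g t" if "s \<in> T" "t \<in> T" "s \<noteq> t" for s t
    proof -
      have "f s = f d" "f t = f d" using T(1) that(1,2) by blast+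
      then have "f s = f t" by simp
      then show ?thesis using inj that by blast
    qed
    then show "\<forall>s\<in>T. \<forall>t\<in>T. s \<noteq> t \<longrightarrow>
        {v \<in> U \<union> W. g v = g s} \<inter> {v \<in> U \<union> W. g v = g t} = {}"
      by auto
  qed (use T fin in auto)
  also have "\<dots> \<le> card (U \<union> W)" using fin by (intro card_mono) auto
  also have "\<dots> \<le> 10" using card_Un_le[of U W] card by simp
  finally show False by simp
qed

text \<open>All common elements turn out to lie on the two lines through some
  \<open>u \<in> U - W\<close>. A line through \<open>w \<in> W - U\<close> that is parallel to, but
  different from, one of these meets the pair at most once, yet must contain two common
  elements.\<close>

lemma lines_imp_eq:
  fixes f g :: "'v \<Rightarrow> 'c"
  assumes card: "card U = 5" "card W = 5"
    and inj: "\<And>x y. f x = f y \<Longrightarrow> g x = g y \<Longrightarrow> x = y"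
    and f: "\<And>d. d \<in> sym_diff U W \<Longrightarrow>
      card {v \<in> U \<inter> W. f v = f d} \<ge> 2 \<or> card {v \<in> sym_diff U W. f v = f d} \<ge> 4"
    and g: "\<And>d. d \<in> sym_diff U W \<Longrightarrow>
      card {v \<in> U \<inter> W. g v = g d} \<ge> 2 \<or> card {v \<in> sym_diff U W. g v = g d} \<ge> 4"
  shows "U = W"
proof (rule ccontr)
  assume neq: "U \<noteq> W"
  have fin: "finite U" "finite W" using card by (auto intro: card_ge_0_finite)
  obtain u where u: "u \<in> U" "u \<notin> W" using neq card fin card_subset_eq[of W U] by auto
  obtain w where w: "w \<in> W" "w \<notin> U" using neq card fin card_subset_eq[of U W] by auto
  have f2: "card {v \<in> U \<inter> W. f v = f d} \<ge> 2" if "d \<in> sym_diff U W" for d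
    by (rule line_card_common_ge_2[OF card inj f g that])
  have g2: "card {v \<in> U \<inter> W. g v = g d} \<ge> 2" if "d \<in> sym_diff U W" for d
    by (rule line_card_common_ge_2[OF card inj g f that])
  let ?F = "{v \<in> U \<inter> W. f v = f u}" and ?G = "{v \<in> U \<inter> W. g v = g u}"
  \<comment> \<open>A common element on both lines would be \<open>u\<close> itself, which is not in
    \<open>W\<close>.\<close>
  have "?F \<inter> ?G = {}" using u inj by blast
  then have "card (?F \<union> ?G) = card ?F + card ?G" using fin by (intro card_Un_disjoint) auto
  then have "card (?F \<union> ?G) \<ge> 4" using f2[of u] g2[of u] u by simp
  moreover have "card (U \<inter> W) < 5"
    using psubset_card_mono[of U "U \<inter> W"] u card fin by auto
  \<comment> \<open>Since \<open>u\<close> is outside \<open>U \<inter> W\<close>, that set has at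
    most four elements, and the four just found exhaust it.\<close>
  ultimately have cross: "?F \<union> ?G = U \<inter> W"
    using fin by (intro card_seteq) auto
  have le1: "card {v \<in> A. f v = c \<and> g v = c'} \<le> 1" if "finite A" for A c c'
    using that inj by (auto simp: card_le_Suc0_iff_eq)
  have "f w = f u"
  proof (rule ccontr)
    assume ne: "f w \<noteq> f u"
    have "g v = g u" if "v \<in> U \<inter> W" "f v = f w" for v
    proof -
      have "v \<in> ?F \<union> ?G" using that(1) by (simp only: cross)
      then show ?thesis using that(2) ne by auto
    qed
    then have "card {v \<in> U \<inter> W. f v = f w} \<le> card {v \<in> U \<inter> W. f v = f w \<and> g v = g u}"
      using fin by (intro card_mono) auto
    then show False using le1[of "U \<inter> W" "f w" "g u"] f2[of w] w fin by simp
  qed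
  moreover have "g w = g u"
  proof (rule ccontr)
    assume ne: "g w \<noteq> g u"
    have "f v = f u" if "v \<in> U \<inter> W" "g v = g w" for v
    proof -
      have "v \<in> ?F \<union> ?G" using that(1) by (simp only: cross)
      then show ?thesis using that(2) ne by auto
    qed
    then have "card {v \<in> U \<inter> W. g v = g w} \<le> card {v \<in> U \<inter> W. f v = f u \<and> g v = g w}"
      using fin by (intro card_mono) auto
    then show False using le1[of "U \<inter> W" "f u" "g w"] g2[of w] w fin by simp
  qed
  ultimately show False using inj[of w u] u w by blast
qed

text \<open>The combinatorial core, free of distances: a path meeting exactly one of two vertices of
  the Kneser graph tells them apart.\<close>

lemma straight_path_separates:
  assumes ab: "a \<ge> 13" "b \<ge> 13"
    and UW: "U \<subseteq> {0..<a} \<times> {0..<b}" "W \<subseteq> {0..<a} \<times> {0..<b}"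
    and card: "card U = 5" "card W = 5" and neq: "U \<noteq> W"
  shows "\<exists>X\<in>straight_paths a b 5. \<not> (X \<inter> U = {} \<longleftrightarrow> X \<inter> W = {})"
proof (rule ccontr)
  assume "\<not> ?thesis"
  then have hits: "X \<inter> U = {} \<longleftrightarrow> X \<inter> W = {}" if "X \<in> straight_paths a b 5" for X
    using that by blast
  have fin: "finite U" "finite W" using card by (auto intro: card_ge_0_finite)
  have "U = W"
  \<comment> \<open>Fixing \<open>snd\<close> gives a cycle of length \<open>a\<close>, fixing
    \<open>fst\<close> one of length \<open>b\<close>.\<close>
  proof (rule lines_imp_eq[of U W snd fst])
    fix d assume d: "d \<in> sym_diff U W"
    then obtain i j where ij: "d = (i, j)" "i < a" "j < b" using UW by auto
    have "card (U \<inter> W \<inter> (\<lambda>i. (i, j)) ` {0..<a}) \<ge> 2 \<or>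
      card (sym_diff U W \<inter> (\<lambda>i. (i, j)) ` {0..<a}) \<ge> 4"
    proof (rule cycle_sym_diff_imp[OF ab(1) _ _ d _ fin])
      show "(\<lambda>t. ((i + t) mod a, j)) ` {0..<5} \<inter> U = {} \<longleftrightarrow>
        (\<lambda>t. ((i + t) mod a, j)) ` {0..<5} \<inter> W = {}" if "i < a" for i
        by (rule hits) (use that ij in \<open>auto simp: straight_paths_def toroidal_grid_def\<close>)
    qed (use ij in \<open>auto simp: inj_on_def\<close>)
    moreover have "U \<inter> W \<inter> (\<lambda>i. (i, j)) ` {0..<a} = {v \<in> U \<inter> W. snd v = snd d}"
      "sym_diff U W \<inter> (\<lambda>i. (i, j)) ` {0..<a} = {v \<in> sym_diff U W. snd v = snd d}"
      using UW ij by auto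
    ultimately show "card {v \<in> U \<inter> W. snd v = snd d} \<ge> 2 \<or>
      card {v \<in> sym_diff U W. snd v = snd d} \<ge> 4" by simp
    have "card (U \<inter> W \<inter> (\<lambda>j. (i, j)) ` {0..<b}) \<ge> 2 \<or>
      card (sym_diff U W \<inter> (\<lambda>j. (i, j)) ` {0..<b}) \<ge> 4"
    proof (rule cycle_sym_diff_imp[OF ab(2) _ _ d _ fin])
      show "(\<lambda>t. (i, (j + t) mod b)) ` {0..<5} \<inter> U = {} \<longleftrightarrow>
        (\<lambda>t. (i, (j + t) mod b)) ` {0..<5} \<inter> W = {}" if "j < b" for j
        by (rule hits) (use that ij in \<open>auto simp: straight_paths_def toroidal_grid_def\<close>)
    qed (use ij in \<open>auto simp: inj_on_def\<close>)
    moreover have "U \<inter> W \<inter> (\<lambda>j. (i, j)) ` {0..<b} = {v \<in> U \<inter> W. fst v = fst d}"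
      "sym_diff U W \<inter> (\<lambda>j. (i, j)) ` {0..<b} = {v \<in> sym_diff U W. fst v = fst d}"
      using UW ij by auto
    ultimately show "card {v \<in> U \<inter> W. fst v = fst d} \<ge> 2 \<or>
      card {v \<in> sym_diff U W. fst v = fst d} \<ge> 4" by simp
  qed (auto simp: card prod_eq_iff)
  then show False using neq by simp
qed

section \<open>Size and number of straight paths\<close>

lemma straight_path_subset_card:
  assumes "m \<le> a" "m \<le> b" "X \<in> straight_paths a b m"
  shows "X \<subseteq> {0..<a} \<times> {0..<b}" "card X = m"
proof -
  \<comment> \<open>A path no longer than its cycle does not run into itself.\<close>
  have inj: "inj_on (\<lambda>t. (i + t) mod c) {0..<m}" if "m \<le> c" for i c
  proof (rule inj_onI)
    fix s t assume st: "s \<in> {0..<m}" "t \<in> {0..<m}" "(i + s) mod c = (i + t) mod c"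
    then have "s mod c = t mod c" by (metis cong_def cong_add_lcancel_nat)
    then show "s = t" using st that by simp
  qed
  have inj': "inj_on (\<lambda>t. ((i + t) mod a, j)) {0..<m}" "inj_on (\<lambda>t. (i, (j + t) mod b)) {0..<m}"
    for i j
    using inj[OF assms(1), of i] inj[OF assms(2), of j]
      inj_on_imageI2[of fst "\<lambda>t. ((i + t) mod a, j)" "{0..<m}"]
      inj_on_imageI2[of snd "\<lambda>t. (i, (j + t) mod b)" "{0..<m}"]
    by (simp_all add: o_def)
  show "X \<subseteq> {0..<a} \<times> {0..<b}" "card X = m"
    using assms(3) inj' by (auto simp: straight_paths_def toroidal_grid_def card_image)
qed

lemma straight_paths_finite_card:
  "finite (straight_paths a b m)" "card (straight_paths a b m) \<le> 2 * (a * b)"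
proof -
  let ?V = "{0..<a} \<times> {0..<b}"
  let ?h = "\<lambda>(i, j). (\<lambda>t. ((i + t) mod a, j)) ` {0..<m}"
  let ?v = "\<lambda>(i, j). (\<lambda>t. (i, (j + t) mod b)) ` {0..<m}"
  have eq: "straight_paths a b m = ?h ` ?V \<union> ?v ` ?V"
    unfolding straight_paths_def toroidal_grid_def by (auto simp: image_iff; blast)
  show "finite (straight_paths a b m)" unfolding eq by simp
  have "card (?h ` ?V) \<le> a * b" "card (?v ` ?V) \<le> a * b"
    by (rule order_trans[OF card_image_le]; simp)+
  then show "card (straight_paths a b m) \<le> 2 * (a * b)"
    unfolding eq using card_Un_le[of "?h ` ?V" "?v ` ?V"] by linarith
qed

section \<open>Distances\<close>

lemma (in pair_wf_digraph) graph_dist_self_le: "u \<in> pverts G \<Longrightarrow> graph_dist G u u \<le> 0"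
  unfolding graph_dist_def
  using min_cost_le_walk_cost[of u "[]" u "\<lambda>_. 1"] by (simp add: awalk_Nil_iff zero_ereal_def)

lemma (in pair_wf_digraph) graph_dist_adj_le: "(u, v) \<in> parcs G \<Longrightarrow> graph_dist G u v \<le> 1"
  unfolding graph_dist_def
  using min_cost_le_walk_cost[of u "[(u, v)]" v "\<lambda>_. 1"] arc_implies_awalk[of "(u, v)"]
  by (simp add: one_ereal_def)

text \<open>With unit weights the cost of a walk is its length. The infimum also covers the case
  without any walk, where the distance is infinite.\<close>

lemma (in pair_wf_digraph) graph_dist_ge:
  assumes "\<And>p. awalk u p v \<Longrightarrow> length p \<ge> k"
  shows "graph_dist G u v \<ge> k"
proof -
  have cost: "awalk_cost (\<lambda>_. 1) p = length p" for p by (induction p) auto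
  show ?thesis unfolding graph_dist_def \<mu>_def cost
    by (rule INF_greatest) (use assms in auto)
qed

lemma (in pair_wf_digraph) graph_dist_ge_1: "u \<noteq> v \<Longrightarrow> graph_dist G u v \<ge> 1"
  using graph_dist_ge[of u v 1] by (force simp: awalk_Nil_iff Suc_le_eq one_ereal_def)

lemma (in pair_wf_digraph) graph_dist_ge_2:
  assumes "u \<noteq> v" "(u, v) \<notin> parcs G"
  shows "graph_dist G u v \<ge> 2"
proof -
  have "length p \<ge> 2" if "awalk u p v" for p
  proof (rule ccontr)
    assume "\<not> length p \<ge> 2"
    then consider "p = []" | e where "p = [e]"
      by (cases p; cases "tl p") auto
    then show False using that assms by cases (auto simp: awalk_simps)
  qed
  then show ?thesis using graph_dist_ge[of u v 2] by simp
qed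

text \<open>Disjointness from \<open>X\<close> means distance exactly 1, whereas a vertex meeting
  \<open>X\<close> is either \<open>X\<close> itself, at distance at most 0, or a nonneighbour, at
  distance at least 2.\<close>

lemma kneser_graph_dist_neq:
  assumes "k \<ge> 1" "U \<in> pverts (kneser_graph n k)" "W \<in> pverts (kneser_graph n k)"
    and "X \<in> pverts (kneser_graph n k)" "U \<inter> X = {}" "W \<inter> X \<noteq> {}"
  shows "graph_dist (kneser_graph n k) U X \<noteq> graph_dist (kneser_graph n k) W X"
proof -
  interpret pair_graph "kneser_graph n k" using pair_graph_kneser_graph assms(1) .
  have "X \<noteq> {}" using assms(6) by blast
  then have "U \<noteq> X" using assms(5) by blast
  moreover have "(U, X) \<in> parcs (kneser_graph n k)"
    using assms by (auto simp: kneser_graph_def)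
  ultimately have 1: "graph_dist (kneser_graph n k) U X = 1"
    using graph_dist_adj_le graph_dist_ge_1 by (simp add: order_antisym)
  show ?thesis
  proof (cases "W = X")
    case True
    then show ?thesis using graph_dist_self_le[of X] assms(4) 1 by auto
  next
    case False
    moreover have "(W, X) \<notin> parcs (kneser_graph n k)"
      using assms by (auto simp: kneser_graph_def)
    ultimately have "graph_dist (kneser_graph n k) W X \<ge> 2" by (rule graph_dist_ge_2)
    then show ?thesis using 1 by auto
  qed
qed

section \<open>From separating paths to resolving sets\<close>

lemma straight_paths_resolving:
  assumes ab: "a \<ge> 13" "b \<ge> 13" and \<phi>: "bij_betw \<phi> ({0..<a} \<times> {0..<b}) {1..n}"
  shows "resolving_set (kneser_graph n 5) ((\<lambda>P. \<phi> ` P) ` straight_paths a b 5)"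
  unfolding resolving_set_def
proof (intro conjI ballI impI)
  let ?V = "{0..<a} \<times> {0..<b}" and ?K = "kneser_graph n 5"
  have inj: "inj_on \<phi> ?V" and img: "\<phi> ` ?V = {1..n}" using \<phi> by (auto simp: bij_betw_def)
  have K: "pverts ?K = {A. A \<subseteq> {1..n} \<and> card A = 5}" by (simp add: kneser_graph_def)
  have path: "\<phi> ` X \<in> pverts ?K" if "X \<in> straight_paths a b 5" for X
  proof -
    have X: "X \<subseteq> ?V" "card X = 5" using straight_path_subset_card[OF _ _ that] ab by auto
    then have "card (\<phi> ` X) = 5" using inj_on_subset[OF inj] by (simp add: card_image)
    then show ?thesis using X img unfolding K by blast
  qed
  then show "(\<lambda>P. \<phi> ` P) ` straight_paths a b 5 \<subseteq> pverts ?K" by blast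
  fix U W assume UW: "U \<in> pverts ?K" "W \<in> pverts ?K" "U \<noteq> W"
  obtain U' where U': "U' \<subseteq> ?V" "U = \<phi> ` U'"
    using UW(1) img unfolding K by (metis (mono_tags, lifting) mem_Collect_eq subset_image_iff)
  obtain W' where W': "W' \<subseteq> ?V" "W = \<phi> ` W'"
    using UW(2) img unfolding K by (metis (mono_tags, lifting) mem_Collect_eq subset_image_iff)
  have "card U' = 5" "card W' = 5"
    using UW(1,2) U' W' inj_on_subset[OF inj] unfolding K by (simp_all add: card_image)
  then obtain X where X: "X \<in> straight_paths a b 5" "\<not> (X \<inter> U' = {} \<longleftrightarrow> X \<inter> W' = {})"
    using straight_path_separates[OF ab U'(1) W'(1)] UW(3) U' W' by blast
  have "X \<subseteq> ?V" using straight_path_subset_card[OF _ _ X(1)] ab by auto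
  \<comment> \<open>Injectivity lets \<open>\<phi>\<close> commute with intersections, so which sets
    a path meets does not depend on the labelling.\<close>
  then have Un: "U \<inter> \<phi> ` X = \<phi> ` (X \<inter> U')" "W \<inter> \<phi> ` X = \<phi> ` (X \<inter> W')"
    using U' W' inj_on_image_Int[OF inj] by (simp_all add: Int_commute)
  have "graph_dist ?K U (\<phi> ` X) \<noteq> graph_dist ?K W (\<phi> ` X)"
  proof (cases "X \<inter> U' = {}")
    case True
    then show ?thesis
      using kneser_graph_dist_neq[OF _ UW(1,2) path[OF X(1)]] X(2) Un by simp
  next
    case False
    then show ?thesis
      using kneser_graph_dist_neq[OF _ UW(2,1) path[OF X(1)]] X(2) Un by fastforce
  qed
  then show "\<exists>X\<in>(\<lambda>P. \<phi> ` P) ` straight_paths a b 5. graph_dist ?K U X \<noteq> graph_dist ?K W X"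
    using X(1) by blast
qed

lemma metric_dimension_le: "resolving_set G S \<Longrightarrow> finite S \<Longrightarrow> metric_dimension G \<le> card S"
  unfolding metric_dimension_def by (rule Least_le) blast

theorem theorem4p8:
  fixes a b n :: nat
  assumes "a \<ge> 13" and "b \<ge> 13" and "n = a * b"
  shows "(\<forall>\<phi>. bij_betw \<phi> (pverts (toroidal_grid a b)) {1..n} \<longrightarrow>
            resolving_set (kneser_graph n 5) ((\<lambda>P. \<phi> ` P) ` straight_paths a b 5))
         \<and> metric_dimension (kneser_graph n 5) \<le> 2 * n"
proof
  have V: "pverts (toroidal_grid a b) = {0..<a} \<times> {0..<b}" by (simp add: toroidal_grid_def)
  show res: "\<forall>\<phi>. bij_betw \<phi> (pverts (toroidal_grid a b)) {1..n} \<longrightarrow>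
      resolving_set (kneser_graph n 5) ((\<lambda>P. \<phi> ` P) ` straight_paths a b 5)"
    unfolding V using straight_paths_resolving[OF assms(1,2)] by blast
  \<comment> \<open>Some labelling exists because both sides have \<open>a * b\<close> elements; any
    one yields the bound.\<close>
  obtain \<phi> where "bij_betw \<phi> ({0..<a} \<times> {0..<b}) {1..n}"
    using finite_same_card_bij[of "{0..<a} \<times> {0..<b}" "{1..n}"] assms(3) by auto
  then have "metric_dimension (kneser_graph n 5) \<le> card ((\<lambda>P. \<phi> ` P) ` straight_paths a b 5)"
    using res straight_paths_finite_card(1) unfolding V by (intro metric_dimension_le) auto
  also have "\<dots> \<le> card (straight_paths a b 5)"
    using straight_paths_finite_card(1) by (rule card_image_le)
  also have "\<dots> \<le> 2 * n" using straight_paths_finite_card(2) assms(3) by simp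
  finally show "metric_dimension (kneser_graph n 5) \<le> 2 * n" .
qed

end
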